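(* Assume: (a) $\mathcal S\subset\mathbb R^m$ and $\mathcal A\subset\mathbb R^n$ are convex and compact; (b) for each $\xi\in\Xi$, $\mathcal C(s,a,\xi)$ is convex and continuous in $(s,a)\in\mathcal S\times\mathcal A$; (c) $g(s,a,\xi)=A(\xi)s+B(\xi)a+b(\xi)$ with $A:\Xi\to\mathbb R^{m\times m}$, $B:\Xi\to\mathbb R^{m\times n}$, $b:\Xi\to\mathbb R^m$ measurable. Let $\mathfrak C_N$ be the (finite) pool of affine cuts $\ell(s)=q^\top s+v$ obtained at episode $N$, and let $$\mathfrak C_N^{\mathrm{valid}}=\Big\{\ell\in\mathfrak C_N:\ \min_{s\in\mathcal S}\big(\hat{\mathcal L}_{N+1}(\ell)(s)-\ell(s)\big)\ge0\Big\}.$$ Let $\underline V_{N+1}^0(s):=\max\big\{-\bar{\mathcal C}/(1-\gamma),\ \max_{\ell\in\mathfrak C_N^{\mathrm{valid}}}\ell(s)\big\}$ for $s\in\mathcal S$. Then $\underline V_{N+1}^0\le\hat{\mathcal L}_{N+1}(\underline V_{N+1}^0)$ on $\mathcal S$, and hence $\underline V_{N+1}^0\le\hat V_{N+1}^*$ on $\mathcal S$.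
   Context: $\mathcal S,\mathcal A$ are nonempty; $\Xi=\{\xi^1,\dots,\xi^J\}\subseteq\mathbb R^k$ is finite; $\mathscr P(\Xi)$ is identified with the probability vectors $(p_j)_{j=1}^J$, $p_j=P(\xi=\xi^j)$. $\mathcal C:\mathcal S\times\mathcal A\times\Xi\to\mathbb R$ is the cost, $g:\mathcal S\times\mathcal A\times\Xi\to\mathcal S$ the transition function, $\gamma\in[0,1)$, $\bar{\mathcal C}=\sup_{s,a,\xi}|\mathcal C(s,a,\xi)|<\infty$. Ambiguity sets: with prior parameters $\tau_{j,0}>1$, data $\hat\xi_1,\hat\xi_2,\dots\in\Xi$, $\tau_{j,M}=\tau_{j,0}+\sum_{i=1}^M\mathbf 1_{\{\hat\xi_i=\xi^j\}}$, $\alpha\in(0,1)$, $\alpha'=\alpha/J$, $z_{1-\alpha'/2}$ the standard normal $(1-\alpha'/2)$-quantile, put for each episode $M$: $\hat p_{j,M}=\frac{\tau_{j,M}-1}{\sum_k\tau_{k,M}-J}$, $\hat r_{j,M}=z_{1-\alpha'/2}\sqrt{\frac{\hat p_{j,M}(1-\hat p_{j,M})}{\sum_k\tau_{k,M}-J}}$, and $\mathfrak P(\hat P_M,\hat r_M)=\{P\in\mathscr P(\Xi):\hat p_{j,M}-\hat r_{j,M}\le p_j\le\hat p_{j,M}+\hat r_{j,M}\ \forall j\}$. For bounded $V:\mathcal S\to\mathbb R$, $\hat{\mathcal L}_M(V)(s)=\inf_{a\in\mathcal A}\sup_{P\in\mathfrak P(\hat P_M,\hat r_M)}\mathbb E_P[\mathcal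 C(s,a,\xi)+\gamma V(g(s,a,\xi))]$, and $\hat V_M^*$ is the unique bounded fixed point of $\hat{\mathcal L}_M$. The pool $\mathfrak C_N$ consists of the affine functions (cuts) generated by a cutting-plane solution of the Bellman equation $V=\hat{\mathcal L}_N(V)$ in episode $N$; elements of $\mathfrak C_N^{\mathrm{valid}}$ are called $(N+1)$-valid. A maximum over an empty set is $-\infty$. *)

theory Defs
  imports "HOL-Probability.Probability"
begin

text \<open>
  The finite support \<open>\<Xi> = {\<xi>\<^sup>1, \<dots>, \<xi>\<^sup>J}\<close> is given by an injective enumeration
  \<open>xi :: 'j::finite \<Rightarrow> real ^ 'k\<close>, so \<open>J = CARD('j)\<close> and \<open>\<Xi> = range xi\<close>.
  A probability measure on \<open>\<Xi>\<close> is its probability vector in \<open>real ^ 'j\<close>.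
\<close>

definition prob_vectors :: "(real ^ 'j::finite) set" where
  "prob_vectors = {p. (\<forall>j. 0 \<le> p $ j) \<and> (\<Sum>j\<in>UNIV. p $ j) = 1}"

definition expect :: "('j::finite \<Rightarrow> 'x) \<Rightarrow> real ^ 'j \<Rightarrow> ('x \<Rightarrow> real) \<Rightarrow> real" where
  "expect xi p f = (\<Sum>j\<in>UNIV. p $ j * f (xi j))"

definition std_normal_quantile :: "real \<Rightarrow> real" where
  "std_normal_quantile q = Inf {x. q \<le> cdf std_normal_distribution x}"

definition posterior_tau ::
  "('j \<Rightarrow> real) \<Rightarrow> ('j \<Rightarrow> 'x) \<Rightarrow> (nat \<Rightarrow> 'x) \<Rightarrow> nat \<Rightarrow> 'j \<Rightarrow> real" where
  "posterior_tau \<tau>0 xi data M j = \<tau>0 j + (\<Sum>i=1..M. indicator {xi j} (data i))"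

definition posterior_mass ::
  "('j::finite \<Rightarrow> real) \<Rightarrow> ('j \<Rightarrow> 'x) \<Rightarrow> (nat \<Rightarrow> 'x) \<Rightarrow> nat \<Rightarrow> real" where
  "posterior_mass \<tau>0 xi data M = (\<Sum>k\<in>UNIV. posterior_tau \<tau>0 xi data M k) - real CARD('j)"

definition p_hat ::
  "('j::finite \<Rightarrow> real) \<Rightarrow> ('j \<Rightarrow> 'x) \<Rightarrow> (nat \<Rightarrow> 'x) \<Rightarrow> nat \<Rightarrow> 'j \<Rightarrow> real" where
  "p_hat \<tau>0 xi data M j =
     (posterior_tau \<tau>0 xi data M j - 1) / posterior_mass \<tau>0 xi data M"

text \<open>The confidence level is split over the \<open>J\<close> coordinates: \<open>\<alpha>' = \<alpha> / J\<close>.\<close>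

definition r_hat ::
  "('j::finite \<Rightarrow> real) \<Rightarrow> ('j \<Rightarrow> 'x) \<Rightarrow> (nat \<Rightarrow> 'x) \<Rightarrow> real \<Rightarrow> nat \<Rightarrow> 'j \<Rightarrow> real" where
  "r_hat \<tau>0 xi data \<alpha> M j =
     std_normal_quantile (1 - (\<alpha> / real CARD('j)) / 2) *
     sqrt (p_hat \<tau>0 xi data M j * (1 - p_hat \<tau>0 xi data M j) / posterior_mass \<tau>0 xi data M)"

definition ambiguity_set ::
  "('j::finite \<Rightarrow> real) \<Rightarrow> ('j \<Rightarrow> 'x) \<Rightarrow> (nat \<Rightarrow> 'x) \<Rightarrow> real \<Rightarrow> nat \<Rightarrow> (real ^ 'j) set" where
  "ambiguity_set \<tau>0 xi data \<alpha> M =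
     {p \<in> prob_vectors. \<forall>j.
        p_hat \<tau>0 xi data M j - r_hat \<tau>0 xi data \<alpha> M j \<le> p $ j \<and>
        p $ j \<le> p_hat \<tau>0 xi data M j + r_hat \<tau>0 xi data \<alpha> M j}"

definition robust_bellman ::
  "'a set \<Rightarrow> (real ^ 'j::finite) set \<Rightarrow> ('j \<Rightarrow> 'x) \<Rightarrow> ('s \<Rightarrow> 'a \<Rightarrow> 'x \<Rightarrow> real) \<Rightarrow>
   ('s \<Rightarrow> 'a \<Rightarrow> 'x \<Rightarrow> 's) \<Rightarrow> real \<Rightarrow> ('s \<Rightarrow> real) \<Rightarrow> 's \<Rightarrow> real" where
  "robust_bellman Act PP xi C g \<gamma> V s =
     (INF a\<in>Act. SUP p\<in>PP. expect xi p (\<lambda>x. C s a x + \<gamma> * V (g s a x)))"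

text \<open>
  Functions on \<open>S\<close> are represented by their extensional representatives; without this,
  the values outside \<open>S\<close> would spoil uniqueness of the fixed point.
\<close>

definition bounded_fixed_point :: "'s set \<Rightarrow> (('s \<Rightarrow> real) \<Rightarrow> 's \<Rightarrow> real) \<Rightarrow> 's \<Rightarrow> real" where
  "bounded_fixed_point S L =
     (THE V. V \<in> extensional S \<and> bounded (V ` S) \<and> (\<forall>s\<in>S. V s = L V s))"

definition cost_bound ::
  "'s set \<Rightarrow> 'a set \<Rightarrow> 'x set \<Rightarrow> ('s \<Rightarrow> 'a \<Rightarrow> 'x \<Rightarrow> real) \<Rightarrow> real" where
  "cost_bound S Act Xi C = (SUP (s, a, x)\<in>S \<times> Act \<times> Xi. \<bar>C s a x\<bar>)"

text \<open>
  The least element of the image is the minimum over \<open>S\<close> in the strict sense: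
  the term is only meaningful when the minimum is attained.
\<close>

definition valid_cuts ::
  "'s set \<Rightarrow> (('s \<Rightarrow> real) \<Rightarrow> 's \<Rightarrow> real) \<Rightarrow> ('s \<Rightarrow> real) set \<Rightarrow> ('s \<Rightarrow> real) set" where
  "valid_cuts S L pool =
     {l \<in> pool. (LEAST y. y \<in> (\<lambda>s. L l s - l s) ` S) \<ge> 0}"

text \<open>
  Inserting the constant into the finite set of cut values yields just the constant
  when there are no cuts, i.e. an empty maximum counts as \<open>-\<infinity>\<close>.
\<close>

definition initial_lower_bound :: "real \<Rightarrow> ('s \<Rightarrow> real) set \<Rightarrow> 's \<Rightarrow> real" where
  "initial_lower_bound c cuts s = Max (insert c ((\<lambda>l. l s) ` cuts))"

end

theory Submission
  imports Defs
begin

text \<open>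
  The robust Bellman operator \<open>L\<close> is monotone and satisfies \<open>L (V + d) \<le> L V + \<gamma> d\<close> for constants \<open>d\<close>,
  so every bounded subsolution \<open>V \<le> L V\<close> lies below the fixed point: with
  \<open>d = sup (V - V\<^sup>*)\<close> one gets \<open>d \<le> \<gamma> d\<close>. Valid cuts and the constant
  \<open>- K / (1 - \<gamma>)\<close> are subsolutions, and by monotonicity so is their maximum.
  Compactness ensures that \<open>L l - l\<close> is continuous and attains its minimum, and the ambiguity
  set contains \<open>p_hat\<close> because the normal quantile above \<open>1 / 2\<close> is nonnegative.
\<close>

section \<open>Monotone discounted operators\<close>

text \<open>The shift \<open>d\<close> may have either sign, so the single axiom
  \<open>discount\<close> contains monotonicity (\<open>d = 0\<close>) as well as the contraction
  estimate. All axioms look at values on \<open>S\<close> only.\<close>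

locale discounted_operator =
  fixes S :: "'s set" and L :: "('s \<Rightarrow> real) \<Rightarrow> 's \<Rightarrow> real" and \<gamma> K :: real
  assumes discount_nonneg: "0 \<le> \<gamma>" and discount_less_1: "\<gamma> < 1"
    and discount: "\<And>V W d s. bounded (V ` S) \<Longrightarrow> bounded (W ` S) \<Longrightarrow>
      (\<And>t. t \<in> S \<Longrightarrow> V t \<le> W t + d) \<Longrightarrow> s \<in> S \<Longrightarrow> L V s \<le> L W s + \<gamma> * d"
    and zero_bound: "\<And>s. s \<in> S \<Longrightarrow> \<bar>L (\<lambda>_. 0) s\<bar> \<le> K"
begin

lemma mono:
  assumes "bounded (V ` S)" and "bounded (W ` S)" and "\<And>t. t \<in> S \<Longrightarrow> V t \<le> W t" and "s \<in> S"
  shows "L V s \<le> L W s"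
  using discount[of V W 0 s] assms by simp

text \<open>Monotonicity in both directions. This allows a function to be replaced by its
  extensional representative on \<open>S\<close>.\<close>

lemma cong:
  assumes "bounded (V ` S)" and "\<And>t. t \<in> S \<Longrightarrow> V t = W t" and "s \<in> S"
  shows "L V s = L W s"
proof -
  have "bounded (W ` S)"
    using assms(1,2) by (metis image_cong)
  then show ?thesis
    using assms by (intro antisym mono) auto
qed

text \<open>Comparison with a supersolution instead of the fixed point itself also yields
  uniqueness: two fixed points can be compared in both orders.\<close>

lemma subsolution_le_supersolution:
  assumes bdd: "bounded (V ` S)" "bounded (W ` S)"
    and sub: "\<And>s. s \<in> S \<Longrightarrow> V s \<le> L V s" and super: "\<And>s. s \<in> S \<Longrightarrow> L W s \<le> W s"
    and s: "s \<in> S"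
  shows "V s \<le> W s"
proof -
  define d where "d = (SUP s\<in>S. V s - W s)"
  have bdd_above: "bdd_above ((\<lambda>s. V s - W s) ` S)"
    using bdd by (intro bounded_imp_bdd_above bounded_minus_comp)
  have le_d: "V t - W t \<le> d" if "t \<in> S" for t
    unfolding d_def using that bdd_above by (rule cSUP_upper)
  have "V t - W t \<le> \<gamma> * d" if t: "t \<in> S" for t
  proof -
    have "L V t \<le> L W t + \<gamma> * d"
      using le_d by (intro discount bdd t) (simp add: algebra_simps)
    then show ?thesis
      using sub[OF t] super[OF t] by simp
  qed
  then have "d \<le> \<gamma> * d"
    unfolding d_def using s by (intro cSUP_least) auto
  then have "(1 - \<gamma>) * d \<le> 0"
    by (simp add: algebra_simps)
  then have "d \<le> 0"
    using discount_less_1 by (simp add: mult_le_0_iff)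
  then show ?thesis
    using le_d[OF s] by simp
qed

text \<open>
  Existence by the Knaster--Tarski construction: the pointwise supremum of the subsolutions
  with values in \<open>[- K / (1 - \<gamma>), K / (1 - \<gamma>)]\<close>, an interval preserved by the operator.
\<close>

lemma ex_fixed_point:
  "\<exists>V. V \<in> extensional S \<and> bounded (V ` S) \<and> (\<forall>s\<in>S. V s = L V s)"
proof -
  define c where "c = K / (1 - \<gamma>)"
  \<comment> \<open>The constant \<open>c\<close> solves this equation, which makes the interval
    from \<open>- c\<close> to \<open>c\<close> invariant under \<open>L\<close>.\<close>
  have K_c: "K + \<gamma> * c = c"
    using discount_less_1 by (simp add: c_def field_simps)
  have bdd: "bounded (W ` S)" if "\<forall>s\<in>S. \<bar>W s\<bar> \<le> c" for W :: "'s \<Rightarrow> real"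
    using that by (auto simp: bounded_iff)
  have preserve: "\<bar>L W s\<bar> \<le> c" if W: "\<forall>s\<in>S. \<bar>W s\<bar> \<le> c" and s: "s \<in> S" for W s
  proof -
    have "L W s \<le> L (\<lambda>_. 0) s + \<gamma> * c" "L (\<lambda>_. 0) s \<le> L W s + \<gamma> * c"
      using W by (auto intro!: discount bdd s)
    then show ?thesis
      using zero_bound[OF s] K_c by linarith
  qed
  define F where "F = {W. (\<forall>s\<in>S. \<bar>W s\<bar> \<le> c) \<and> (\<forall>s\<in>S. W s \<le> L W s)}"
  define U where "U = (\<lambda>s. SUP W\<in>F. W s)"
  \<comment> \<open>If \<open>S\<close> is empty, \<open>K\<close> may be negative; the sign of
    \<open>c\<close> is therefore claimed only in the presence of a point of
    \<open>S\<close>.\<close>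
  have c_nonneg: "0 \<le> c" if "s \<in> S" for s
    using zero_bound[OF that] discount_less_1 by (auto simp: c_def)
  have "(\<lambda>_. - c) \<in> F"
    using preserve[of "\<lambda>_. - c"] c_nonneg by (force simp: F_def)
  then have F_ne: "F \<noteq> {}" by auto
  have bdd_F: "bdd_above ((\<lambda>W. W s) ` F)" if "s \<in> S" for s
    using that by (auto simp: F_def abs_le_iff intro!: bdd_aboveI2[where M = c])
  have le_U: "W s \<le> U s" if "W \<in> F" "s \<in> S" for W s
    unfolding U_def using bdd_F that by (intro cSUP_upper) auto
  have U_bound: "\<forall>s\<in>S. \<bar>U s\<bar> \<le> c"
  proof
    fix s assume s: "s \<in> S"
    have "U s \<le> c"
      unfolding U_def using F_ne s by (intro cSUP_least) (auto simp: F_def abs_le_iff)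
    moreover have "- c \<le> U s"
      using le_U[OF \<open>(\<lambda>_. - c) \<in> F\<close> s] .
    ultimately show "\<bar>U s\<bar> \<le> c" by simp
  qed
  have U_sub: "U s \<le> L U s" if s: "s \<in> S" for s
    unfolding U_def
  proof (rule cSUP_least[OF F_ne])
    fix W assume W: "W \<in> F"
    have "W s \<le> L W s"
      using W s by (simp add: F_def)
    also have "\<dots> \<le> L U s"
      using W U_bound le_U[OF W] by (intro mono bdd s) (auto simp: F_def)
    finally show "W s \<le> L (\<lambda>s. SUP W\<in>F. W s) s"
      by (simp add: U_def)
  qed
  \<comment> \<open>Applying \<open>L\<close> to \<open>U \<le> L U\<close> shows that
    \<open>L U\<close> is again a subsolution, so it lies below the supremum \<open>U\<close>, which
    gives the reverse inequality.\<close>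
  have "L U \<in> F"
    using preserve[OF U_bound] U_sub U_bound
    by (auto simp: F_def intro!: mono bdd)
  then have fixed: "U s = L U s" if "s \<in> S" for s
    using le_U U_sub that by (intro antisym)
  have "bounded (restrict U S ` S)"
    using bdd[OF U_bound] by (metis image_restrict_eq)
  moreover have "restrict U S s = L (restrict U S) s" if s: "s \<in> S" for s
  proof -
    have "restrict U S s = L U s"
      using fixed[OF s] s by (metis restrict_apply')
    also have "\<dots> = L (restrict U S) s"
      by (rule cong[OF bdd[OF U_bound] _ s]) simp
    finally show ?thesis .
  qed
  ultimately show ?thesis
    by (intro exI[of _ "restrict U S"]) auto
qed

text \<open>Comparison shows that two candidates agree on \<open>S\<close>; extensionality turns
  this into equality, so the definite description is well defined.\<close>

lemma bounded_fixed_point: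
  defines "V \<equiv> bounded_fixed_point S L"
  shows "V \<in> extensional S" and "bounded (V ` S)" and "\<And>s. s \<in> S \<Longrightarrow> V s = L V s"
proof -
  have "\<exists>!V. V \<in> extensional S \<and> bounded (V ` S) \<and> (\<forall>s\<in>S. V s = L V s)"
  proof (rule ex_ex1I[OF ex_fixed_point])
    fix V W
    assume V: "V \<in> extensional S \<and> bounded (V ` S) \<and> (\<forall>s\<in>S. V s = L V s)"
      and W: "W \<in> extensional S \<and> bounded (W ` S) \<and> (\<forall>s\<in>S. W s = L W s)"
    then have "V s = W s" if "s \<in> S" for s
      using that subsolution_le_supersolution[of V W s] subsolution_le_supersolution[of W V s]
      by fastforce
    then show "V = W"
      using V W by (intro extensionalityI) auto
  qed
  from theI'[OF this]
  show "V \<in> extensional S" "bounded (V ` S)" "\<And>s. s \<in> S \<Longrightarrow> V s = L V s"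
    unfolding V_def bounded_fixed_point_def by blast+
qed

lemma subsolution_le_bounded_fixed_point:
  assumes "bounded (V ` S)" and "\<And>s. s \<in> S \<Longrightarrow> V s \<le> L V s" and "s \<in> S"
  shows "V s \<le> bounded_fixed_point S L s"
  using assms(1) bounded_fixed_point(2) assms(2) eq_refl[OF bounded_fixed_point(3)[symmetric]] assms(3)
  by (rule subsolution_le_supersolution)

text \<open>At each point the maximum equals one member of the family; that member is a subsolution
  lying below the maximum, so monotonicity of \<open>L\<close> finishes the argument.\<close>

lemma initial_lower_bound_subsolution:
  assumes "finite cuts" and bdd: "\<And>l. l \<in> cuts \<Longrightarrow> bounded (l ` S)"
    and cuts_sub: "\<And>l s. l \<in> cuts \<Longrightarrow> s \<in> S \<Longrightarrow> l s \<le> L l s"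
    and const_sub: "\<And>s. s \<in> S \<Longrightarrow> c \<le> L (\<lambda>_. c) s"
  defines "V \<equiv> initial_lower_bound c cuts"
  shows "bounded (V ` S)" and "\<And>s. s \<in> S \<Longrightarrow> V s \<le> L V s"
proof -
  \<comment> \<open>Treating the constant as one more cut keeps the family nonempty, so that
    \<open>Max\<close> is always meaningful.\<close>
  define X where "X = insert (\<lambda>_. c) cuts"
  have X: "finite X" "X \<noteq> {}" "\<And>l. l \<in> X \<Longrightarrow> bounded (l ` S)"
    "\<And>l s. l \<in> X \<Longrightarrow> s \<in> S \<Longrightarrow> l s \<le> L l s"
    using assms by (auto simp: X_def image_constant_conv)
  have V_eq: "V s = Max ((\<lambda>l. l s) ` X)" for s
    by (simp add: V_def initial_lower_bound_def X_def)
  have le_V: "l s \<le> V s" if "l \<in> X" for l s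
    using that X(1) by (simp add: V_eq)
  have V_in: "\<exists>l\<in>X. V s = l s" for s
    unfolding V_eq using Max_in[of "(\<lambda>l. l s) ` X"] X(1,2) by blast
  have "V ` S \<subseteq> (\<Union>l\<in>X. l ` S)"
    using V_in by fastforce
  moreover have "bounded (\<Union>l\<in>X. l ` S)"
    using X(1,3) by (intro bounded_UN) auto
  ultimately show bdd_V: "bounded (V ` S)"
    by (rule bounded_subset[rotated])
  fix s assume s: "s \<in> S"
  obtain l where l: "l \<in> X" "V s = l s"
    using V_in by blast
  have "l s \<le> L l s"
    using X(4) l(1) s .
  also have "\<dots> \<le> L V s"
    using X(3) l(1) bdd_V le_V s by (intro mono) auto
  finally show "V s \<le> L V s"
    using l(2) by simp
qed

end

section \<open>The robust Bellman operator\<close>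

lemma expect_mono:
  assumes "p \<in> prob_vectors" and "\<And>j. f (xi j) \<le> h (xi j) + e"
  shows "expect xi p f \<le> expect xi p h + e"
proof -
  have "expect xi p f \<le> (\<Sum>j\<in>UNIV. p $ j * (h (xi j) + e))"
    unfolding expect_def using assms by (intro sum_mono mult_left_mono) (auto simp: prob_vectors_def)
  also have "\<dots> = expect xi p h + (\<Sum>j\<in>UNIV. p $ j) * e"
    by (simp add: expect_def distrib_left sum.distrib sum_distrib_right)
  finally show ?thesis
    using assms(1) by (simp add: prob_vectors_def)
qed

lemma expect_const:
  assumes "p \<in> prob_vectors"
  shows "expect xi p (\<lambda>_. c) = c"
  using assms by (simp add: expect_def prob_vectors_def flip: sum_distrib_right)

lemma abs_expect_le:
  assumes "p \<in> prob_vectors" and "\<And>j. \<bar>f (xi j)\<bar> \<le> K"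
  shows "\<bar>expect xi p f\<bar> \<le> K"
proof -
  have "f (xi j) \<le> 0 + K" and "0 \<le> f (xi j) + K" for j
    using assms(2)[of j] by auto
  then show ?thesis
    using expect_mono[OF assms(1), of f xi "\<lambda>_. 0" K] expect_mono[OF assms(1), of "\<lambda>_. 0" xi f K]
    by (auto simp: expect_const assms(1))
qed

text \<open>A uniform shift of the integrand passes through expectation, supremum and infimum. Both
  the discount property and continuity in the state rest on this estimate. The bounds
  \<open>K\<close> and \<open>K'\<close> make the real-valued \<open>SUP\<close> and
  \<open>INF\<close> well behaved.\<close>

lemma INF_SUP_expect_mono:
  assumes Act: "Act \<noteq> {}" and PP: "PP \<noteq> {}" "PP \<subseteq> prob_vectors"
    and f: "\<And>a j. a \<in> Act \<Longrightarrow> \<bar>f a (xi j)\<bar> \<le> K"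
    and h: "\<And>a j. a \<in> Act \<Longrightarrow> \<bar>h a (xi j)\<bar> \<le> K'"
    and le: "\<And>a j. a \<in> Act \<Longrightarrow> f a (xi j) \<le> h a (xi j) + e"
  shows "(INF a\<in>Act. SUP p\<in>PP. expect xi p (f a)) \<le> (INF a\<in>Act. SUP p\<in>PP. expect xi p (h a)) + e"
proof -
  have upper: "expect xi p (u a) \<le> (SUP p\<in>PP. expect xi p (u a))"
    if "a \<in> Act" "p \<in> PP" "\<And>a j. a \<in> Act \<Longrightarrow> \<bar>u a (xi j)\<bar> \<le> M" for u a p M
  proof (rule cSUP_upper)
    show "bdd_above ((\<lambda>p. expect xi p (u a)) ` PP)"
      using abs_expect_le[of _ "u a" xi M] that PP(2)
      by (intro bdd_aboveI2[where M = M]) (force simp: abs_le_iff)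
  qed fact
  have bdd: "bdd_below ((\<lambda>a. SUP p\<in>PP. expect xi p (f a)) ` Act)"
  proof (rule bdd_belowI2)
    fix a assume a: "a \<in> Act"
    obtain p where p: "p \<in> PP"
      using PP(1) by auto
    have "- K \<le> expect xi p (f a)"
      using abs_expect_le[of p "f a" xi K] f a p PP(2) by (force simp: abs_le_iff)
    with upper[of a p f K] a p f show "- K \<le> (SUP p\<in>PP. expect xi p (f a))"
      by force
  qed
  have "(INF a\<in>Act. SUP p\<in>PP. expect xi p (f a)) - e \<le> (INF a\<in>Act. SUP p\<in>PP. expect xi p (h a))"
  proof (rule cINF_greatest[OF Act])
    fix a assume a: "a \<in> Act"
    have "(SUP p\<in>PP. expect xi p (f a)) \<le> (SUP p\<in>PP. expect xi p (h a)) + e"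
    proof (rule cSUP_least[OF PP(1)])
      fix p assume p: "p \<in> PP"
      have "expect xi p (f a) \<le> expect xi p (h a) + e"
        using p PP(2) le[OF a] by (intro expect_mono) auto
      then show "expect xi p (f a) \<le> (SUP p\<in>PP. expect xi p (h a)) + e"
        using upper[of a p h K'] a p h by force
    qed
    moreover have "(INF a\<in>Act. SUP p\<in>PP. expect xi p (f a)) \<le> (SUP p\<in>PP. expect xi p (f a))"
      using bdd a by (rule cINF_lower)
    ultimately show "(INF a\<in>Act. SUP p\<in>PP. expect xi p (f a)) - e \<le> (SUP p\<in>PP. expect xi p (h a))"
      by simp
  qed
  then show ?thesis by simp
qed

text \<open>The integrand is uniformly continuous on the compact set \<open>S \<times> Act\<close>,
  so nearby states give integrands that are close uniformly in the action; the previous estimate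
  carries this to the min-max value.\<close>

lemma continuous_on_INF_SUP_expect:
  fixes f :: "'s::metric_space \<Rightarrow> 'a::metric_space \<Rightarrow> 'x \<Rightarrow> real" and xi :: "'j::finite \<Rightarrow> 'x"
  assumes Act: "Act \<noteq> {}" and PP: "PP \<noteq> {}" "PP \<subseteq> prob_vectors"
    and compact: "compact (S \<times> Act)"
    and cont: "\<And>j. continuous_on (S \<times> Act) (\<lambda>(s, a). f s a (xi j))"
  shows "continuous_on S (\<lambda>s. INF a\<in>Act. SUP p\<in>PP. expect xi p (f s a))"
proof -
  \<comment> \<open>Collecting the finitely many scenarios in one vector gives a single bound and a
    single modulus of continuity for all \<open>j\<close>.\<close>
  define F :: "'s \<times> 'a \<Rightarrow> real ^ 'j" where "F = (\<lambda>(s, a). \<chi> j. f s a (xi j))"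
  have F: "F (s, a) $ j = f s a (xi j)" for s a j
    by (simp add: F_def)
  have cont_F: "continuous_on (S \<times> Act) F"
    using cont by (auto simp: F_def case_prod_unfold intro!: continuous_intros)
  have "bounded (F ` (S \<times> Act))"
    using compact_continuous_image[OF cont_F compact] by (rule compact_imp_bounded)
  then obtain K where "\<And>s a. s \<in> S \<Longrightarrow> a \<in> Act \<Longrightarrow> norm (F (s, a)) \<le> K"
    by (auto simp: bounded_iff)
  then have bound: "\<bar>f s a (xi j)\<bar> \<le> K" if "s \<in> S" "a \<in> Act" for s a j
    using that component_le_norm_cart[of "F (s, a)" j] by (force simp: F)
  show ?thesis
    unfolding continuous_on_iff
  proof (intro ballI allI impI)
    fix s and e :: real assume s: "s \<in> S" and e: "0 < e"
    obtain d where d: "0 < d"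
      "\<And>x y. x \<in> S \<times> Act \<Longrightarrow> y \<in> S \<times> Act \<Longrightarrow> dist x y < d \<Longrightarrow> dist (F x) (F y) < e / 2"
      using compact_uniformly_continuous[OF cont_F compact] e
      unfolding uniformly_continuous_on_def by (metis half_gt_zero)
    \<comment> \<open>Stated for any two close states, to be used in both orders. Since the estimate
      is not strict, \<open>e / 2\<close> leaves room for the strict bound \<open>e\<close>.\<close>
    have close: "(INF a\<in>Act. SUP p\<in>PP. expect xi p (f s a))
        \<le> (INF a\<in>Act. SUP p\<in>PP. expect xi p (f t a)) + e / 2"
      if "s \<in> S" "t \<in> S" "dist s t < d" for s t
    proof (rule INF_SUP_expect_mono[OF Act PP])
      show "f s a (xi j) \<le> f t a (xi j) + e / 2" if "a \<in> Act" for a j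
      proof -
        have "dist (F (s, a)) (F (t, a)) < e / 2"
          using \<open>s \<in> S\<close> \<open>t \<in> S\<close> \<open>dist s t < d\<close> that by (intro d(2)) (auto simp: dist_Pair_Pair)
        then show ?thesis
          using component_le_norm_cart[of "F (s, a) - F (t, a)" j]
          by (simp add: F dist_norm)
      qed
    qed (use bound that in auto)
    have "dist (INF a\<in>Act. SUP p\<in>PP. expect xi p (f t a))
        (INF a\<in>Act. SUP p\<in>PP. expect xi p (f s a)) < e" if "t \<in> S" "dist t s < d" for t
      using close[OF s that(1)] close[OF that(1) s] that e by (auto simp: dist_real_def dist_commute)
    with d(1) show "\<exists>d>0. \<forall>t\<in>S. dist t s < d \<longrightarrow>
        dist (INF a\<in>Act. SUP p\<in>PP. expect xi p (f t a))
          (INF a\<in>Act. SUP p\<in>PP. expect xi p (f s a)) < e"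
      by blast
  qed
qed

lemma discounted_operator_robust_bellman:
  fixes C :: "'s \<Rightarrow> 'a \<Rightarrow> 'x \<Rightarrow> real" and xi :: "'j::finite \<Rightarrow> 'x"
  assumes Act: "Act \<noteq> {}" and PP: "PP \<noteq> {}" "PP \<subseteq> prob_vectors"
    and g: "\<And>s a j. s \<in> S \<Longrightarrow> a \<in> Act \<Longrightarrow> g s a (xi j) \<in> S"
    and C: "\<And>s a j. s \<in> S \<Longrightarrow> a \<in> Act \<Longrightarrow> \<bar>C s a (xi j)\<bar> \<le> K"
    and \<gamma>: "0 \<le> \<gamma>" "\<gamma> < 1"
  shows "discounted_operator S (robust_bellman Act PP xi C g \<gamma>) \<gamma> K"
proof
  have bound: "\<exists>K. \<forall>a\<in>Act. \<forall>j. \<bar>C s a (xi j) + \<gamma> * V (g s a (xi j))\<bar> \<le> K"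
    if V: "bounded (V ` S)" and s: "s \<in> S" for V s
  proof -
    obtain M where "\<forall>t\<in>S. \<bar>V t\<bar> \<le> M"
      using V by (auto simp: bounded_iff)
    then have M: "\<bar>V t\<bar> \<le> M" if "t \<in> S" for t
      using that by blast
    have "\<bar>C s a (xi j) + \<gamma> * V (g s a (xi j))\<bar> \<le> K + \<gamma> * M" if "a \<in> Act" for a j
    proof -
      have "\<bar>C s a (xi j) + \<gamma> * V (g s a (xi j))\<bar> \<le> \<bar>C s a (xi j)\<bar> + \<gamma> * \<bar>V (g s a (xi j))\<bar>"
        using abs_triangle_ineq[of "C s a (xi j)" "\<gamma> * V (g s a (xi j))"] \<gamma> by (simp add: abs_mult)
      also have "\<dots> \<le> K + \<gamma> * M"
        using s that by (intro add_mono mult_left_mono C M g \<gamma>)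
      finally show ?thesis .
    qed
    then show ?thesis by blast
  qed
  fix V W :: "'s \<Rightarrow> real" and d s
  assume V: "bounded (V ` S)" and W: "bounded (W ` S)"
    and le: "\<And>t. t \<in> S \<Longrightarrow> V t \<le> W t + d" and s: "s \<in> S"
  obtain KV KW where
    "\<And>a j. a \<in> Act \<Longrightarrow> \<bar>C s a (xi j) + \<gamma> * V (g s a (xi j))\<bar> \<le> KV"
    "\<And>a j. a \<in> Act \<Longrightarrow> \<bar>C s a (xi j) + \<gamma> * W (g s a (xi j))\<bar> \<le> KW"
    using bound[OF V s] bound[OF W s] by blast
  moreover have "C s a (xi j) + \<gamma> * V (g s a (xi j)) \<le> C s a (xi j) + \<gamma> * W (g s a (xi j)) + \<gamma> * d"
    if "a \<in> Act" for a j
    using mult_left_mono[OF le[OF g[OF s that]] \<gamma>(1)] by (simp add: algebra_simps)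
  ultimately show "robust_bellman Act PP xi C g \<gamma> V s \<le> robust_bellman Act PP xi C g \<gamma> W s + \<gamma> * d"
    unfolding robust_bellman_def by (rule INF_SUP_expect_mono[OF Act PP])
next
  fix s assume s: "s \<in> S"
  \<comment> \<open>Needed because \<open>K\<close> also serves as the bound of the zero integrand
    below.\<close>
  have K: "0 \<le> K"
    using C[OF s] Act by (meson abs_ge_zero all_not_in_conv order_trans)
  have const: "(INF a\<in>Act. SUP p\<in>PP. expect xi p (\<lambda>_. 0)) = 0"
    using Act PP by (simp add: expect_def)
  have "(INF a\<in>Act. SUP p\<in>PP. expect xi p (C s a))
      \<le> (INF a\<in>Act. SUP p\<in>PP. expect xi p (\<lambda>_. 0)) + K"
    using C[OF s] K by (intro INF_SUP_expect_mono[OF Act PP, where K = K and K' = K]) (auto simp: abs_le_iff)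
  moreover have "(INF a\<in>Act. SUP p\<in>PP. expect xi p (\<lambda>_. 0))
      \<le> (INF a\<in>Act. SUP p\<in>PP. expect xi p (C s a)) + K"
  proof (rule INF_SUP_expect_mono[OF Act PP])
    show "0 \<le> C s a (xi j) + K" if "a \<in> Act" for a j
      using C[OF s that, of j] by linarith
  qed (use C[OF s] K in auto)
  ultimately show "\<bar>robust_bellman Act PP xi C g \<gamma> (\<lambda>_. 0) s\<bar> \<le> K"
    by (simp add: robust_bellman_def const)
qed (use \<gamma> in auto)

section \<open>Nonemptiness of the ambiguity sets\<close>

text \<open>By symmetry of the density the tails \<open>{..x}\<close> and \<open>{- x..}\<close>
  have equal mass; for \<open>x < 0\<close> they are disjoint, so twice this mass is at most
  1.\<close>

lemma cdf_std_normal_le_half: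
  assumes "x < 0"
  shows "cdf std_normal_distribution x \<le> 1 / 2"
proof -
  interpret real_distribution std_normal_distribution
    by (rule real_dist_normal_dist)
  have "emeasure std_normal_distribution {..x} =
      (\<integral>\<^sup>+ y. ennreal (std_normal_density y) * indicator {..x} y \<partial>lborel)"
    by (simp add: emeasure_density)
  \<comment> \<open>Reflection invariance of Lebesgue measure supplies the change of variable from
    \<open>y\<close> to \<open>- y\<close>.\<close>
  also have "\<dots> = (\<integral>\<^sup>+ y. ennreal (std_normal_density y) * indicator {..x} y \<partial>distr lborel borel uminus)"
    by (simp only: lborel_distr_uminus)
  also have "\<dots> = (\<integral>\<^sup>+ y. ennreal (std_normal_density y) * indicator {- x..} y \<partial>lborel)"
    by (subst nn_integral_distr)
      (auto simp: std_normal_density_def indicator_def minus_le_iff intro!: nn_integral_cong)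
  also have "\<dots> = emeasure std_normal_distribution {- x..}"
    by (simp add: emeasure_density)
  finally have "prob {..x} = prob {- x..}"
    by (simp add: measure_def)
  moreover have "prob ({..x} \<union> {- x..}) = prob {..x} + prob {- x..}"
    using assms by (intro finite_measure_Union) auto
  ultimately show ?thesis
    using prob_le_1[of "{..x} \<union> {- x..}"] by (simp add: cdf_def)
qed

text \<open>Negative points have cdf at most \<open>1 / 2\<close>, hence below \<open>q\<close>. The
  limit 1 of the cdf at infinity makes the set nonempty, without which its \<open>Inf\<close> would
  be uninformative.\<close>

lemma std_normal_quantile_nonneg:
  assumes "1 / 2 < q" and "q < 1"
  shows "0 \<le> std_normal_quantile q"
  unfolding std_normal_quantile_def
proof (rule cInf_greatest)
  have "eventually (\<lambda>x. q < cdf std_normal_distribution x) at_top"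
    using real_distribution.cdf_lim_at_top_prob[OF real_dist_normal_dist] assms(2)
    by (rule order_tendstoD)
  then have "\<exists>x. q < cdf std_normal_distribution x"
    by (rule eventually_happens'[OF trivial_limit_at_top_linorder])
  then show "{x. q \<le> cdf std_normal_distribution x} \<noteq> {}"
    by (auto intro: less_imp_le)
  show "0 \<le> x" if "x \<in> {x. q \<le> cdf std_normal_distribution x}" for x
    using that cdf_std_normal_le_half[of x] assms(1) by force
qed

lemma p_hat_prob_vector:
  assumes "\<And>j. 1 < \<tau>0 j"
  shows "(\<chi> j. p_hat \<tau>0 xi data M j) \<in> prob_vectors" and "0 < posterior_mass \<tau>0 xi data M"
proof -
  have tau: "1 < posterior_tau \<tau>0 xi data M j" for j
    using assms[of j] unfolding posterior_tau_def
    by (smt (verit) indicator_pos_le sum_nonneg)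
  \<comment> \<open>Subtracting \<open>J\<close> from the total removes 1 from each coordinate, so
    the mass is exactly the normalizing constant of \<open>p_hat\<close>.\<close>
  have mass: "posterior_mass \<tau>0 xi data M = (\<Sum>j\<in>UNIV. posterior_tau \<tau>0 xi data M j - 1)"
    by (simp add: posterior_mass_def sum_subtractf)
  show pos: "0 < posterior_mass \<tau>0 xi data M"
    unfolding mass using tau by (intro sum_pos) auto
  have "(\<Sum>j\<in>UNIV. p_hat \<tau>0 xi data M j) = 1"
    using pos by (simp add: p_hat_def flip: sum_divide_distrib mass)
  moreover have "0 \<le> p_hat \<tau>0 xi data M j" for j
    using pos tau[of j] by (simp add: p_hat_def)
  ultimately show "(\<chi> j. p_hat \<tau>0 xi data M j) \<in> prob_vectors"
    by (simp add: prob_vectors_def)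
qed

lemma prob_vectors_component_le_1:
  assumes "p \<in> prob_vectors"
  shows "p $ j \<le> 1"
  using assms member_le_sum[of j UNIV "($) p"] by (simp add: prob_vectors_def)

lemma ambiguity_set_nonempty:
  fixes \<tau>0 :: "'j::finite \<Rightarrow> real"
  assumes "\<And>j. 1 < \<tau>0 j" and "0 < \<alpha>" and "\<alpha> < 1"
  shows "ambiguity_set \<tau>0 xi data \<alpha> M \<noteq> {}"
proof -
  let ?p = "\<chi> j. p_hat \<tau>0 xi data M j"
  have p: "?p \<in> prob_vectors" and mass: "0 < posterior_mass \<tau>0 xi data M"
    using p_hat_prob_vector assms(1) by blast+
  \<comment> \<open>With at least one scenario, \<open>\<alpha> / J\<close> stays below 1, which
    puts the quantile level strictly between \<open>1 / 2\<close> and 1.\<close>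
  have "1 \<le> real CARD('j)"
    by (simp add: Suc_leI)
  then have "\<alpha> < real CARD('j)"
    using assms(3) by linarith
  then have "0 < \<alpha> / real CARD('j)" "\<alpha> / real CARD('j) < 1"
    using assms(2,3) by (simp_all add: divide_less_eq)
  then have "0 \<le> std_normal_quantile (1 - (\<alpha> / real CARD('j)) / 2)"
    by (intro std_normal_quantile_nonneg) auto
  \<comment> \<open>Both bounds matter: \<open>sqrt\<close> of a negative number is negative, so the
    sign of the radius depends on that of \<open>p (1 - p)\<close>.\<close>
  moreover have "0 \<le> p_hat \<tau>0 xi data M j" "p_hat \<tau>0 xi data M j \<le> 1" for j
    using p prob_vectors_component_le_1[OF p, of j] by (auto simp: prob_vectors_def)
  ultimately have "0 \<le> r_hat \<tau>0 xi data \<alpha> M j" for j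
    using mass by (simp add: r_hat_def)
  with p have "?p \<in> ambiguity_set \<tau>0 xi data \<alpha> M"
    by (simp add: ambiguity_set_def)
  then show ?thesis by blast
qed

section \<open>Valid cuts\<close>

text \<open>
  The least element in the definition of valid cuts is an unspecified value unless
  the minimum is attained, hence the continuity hypothesis.
\<close>

lemma valid_cutsD:
  assumes "l \<in> valid_cuts S L pool" and "compact S" and "continuous_on S (\<lambda>s. L l s - l s)"
    and "s \<in> S"
  shows "l s \<le> L l s"
proof -
  obtain t where t: "t \<in> S" "\<And>s. s \<in> S \<Longrightarrow> L l t - l t \<le> L l s - l s"
    using continuous_attains_inf[OF assms(2) _ assms(3)] assms(4) by blast
  then have "(LEAST y. y \<in> (\<lambda>s. L l s - l s) ` S) = L l t - l t"
    by (intro Least_equality) auto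
  then show ?thesis
    using assms(1) t(2)[OF assms(4)] by (simp add: valid_cuts_def)
qed


section \<open>Lower bound from the cuts retained for the next episode\<close>

theorem proposition4:
  fixes S :: "(real ^ 'm) set" and Act :: "(real ^ 'n) set"
    and xi :: "'j::finite \<Rightarrow> real ^ 'k"
    and C :: "real ^ 'm \<Rightarrow> real ^ 'n \<Rightarrow> real ^ 'k \<Rightarrow> real"
    and g :: "real ^ 'm \<Rightarrow> real ^ 'n \<Rightarrow> real ^ 'k \<Rightarrow> real ^ 'm"
    and A :: "real ^ 'k \<Rightarrow> real ^ 'm ^ 'm"
    and B :: "real ^ 'k \<Rightarrow> real ^ 'n ^ 'm"
    and b :: "real ^ 'k \<Rightarrow> real ^ 'm"
    and \<gamma> \<alpha> :: real and \<tau>0 :: "'j \<Rightarrow> real" and data :: "nat \<Rightarrow> real ^ 'k"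
    and N :: nat and pool :: "(real ^ 'm \<Rightarrow> real) set"
  assumes "S \<noteq> {}" and "Act \<noteq> {}" and "inj xi"
    and g_into: "\<And>s a x. s \<in> S \<Longrightarrow> a \<in> Act \<Longrightarrow> x \<in> range xi \<Longrightarrow> g s a x \<in> S"
    and "0 \<le> \<gamma>" and "\<gamma> < 1"
    and cost_bounded: "bdd_above ((\<lambda>(s, a, x). \<bar>C s a x\<bar>) ` (S \<times> Act \<times> range xi))"
    and prior: "\<And>j. \<tau>0 j > 1"
    and data: "\<And>i. i \<ge> 1 \<Longrightarrow> data i \<in> range xi"
    and "0 < \<alpha>" and "\<alpha> < 1"
    and "convex S" and "compact S" and "convex Act" and "compact Act"
    and cost_convex: "\<And>x. x \<in> range xi \<Longrightarrow> convex_on (S \<times> Act) (\<lambda>(s, a). C s a x)"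
    and cost_continuous: "\<And>x. x \<in> range xi \<Longrightarrow> continuous_on (S \<times> Act) (\<lambda>(s, a). C s a x)"
    and g_affine: "\<And>s a x. s \<in> S \<Longrightarrow> a \<in> Act \<Longrightarrow> x \<in> range xi \<Longrightarrow>
           g s a x = A x *v s + B x *v a + b x"
    and "A \<in> borel_measurable (restrict_space borel (range xi))"
    and "B \<in> borel_measurable (restrict_space borel (range xi))"
    and "b \<in> borel_measurable (restrict_space borel (range xi))"
    and "finite pool"
    and cuts_affine: "\<And>l. l \<in> pool \<Longrightarrow> \<exists>q v. l = (\<lambda>s. q \<bullet> s + v)"
  shows "let L = robust_bellman Act (ambiguity_set \<tau>0 xi data \<alpha> (N + 1)) xi C g \<gamma>;
             V0 = initial_lower_bound (- cost_bound S Act (range xi) C / (1 - \<gamma>))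
                    (valid_cuts S L pool)
         in (\<forall>s\<in>S. V0 s \<le> L V0 s) \<and> (\<forall>s\<in>S. V0 s \<le> bounded_fixed_point S L s)"
proof -
  define PP where "PP = ambiguity_set \<tau>0 xi data \<alpha> (N + 1)"
  define L where "L = robust_bellman Act PP xi C g \<gamma>"
  define K where "K = cost_bound S Act (range xi) C"
  have PP: "PP \<noteq> {}" "PP \<subseteq> prob_vectors"
    unfolding PP_def using ambiguity_set_nonempty[of \<tau>0 \<alpha>] prior \<open>0 < \<alpha>\<close> \<open>\<alpha> < 1\<close>
    by blast (auto simp: ambiguity_set_def)
  have C_le: "\<bar>C s a (xi j)\<bar> \<le> K" if "s \<in> S" "a \<in> Act" for s a j
    using cSUP_upper[OF _ cost_bounded, of "(s, a, xi j)"] that by (simp add: K_def cost_bound_def)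
  interpret discounted_operator S L \<gamma> K
    unfolding L_def using \<open>Act \<noteq> {}\<close> PP g_into C_le \<open>0 \<le> \<gamma>\<close> \<open>\<gamma> < 1\<close>
    by (intro discounted_operator_robust_bellman) auto
  \<comment> \<open>The domain is left free: \<open>UNIV\<close> is used when composing with
    \<open>g\<close>, and \<open>S\<close> for boundedness and attainment of the minimum.\<close>
  have cut_continuous: "continuous_on T l" if "l \<in> pool" for l T
    using cuts_affine[OF that] by (auto intro!: continuous_intros)
  have L_continuous: "continuous_on S (L l)" if l: "l \<in> pool" for l
    unfolding L_def robust_bellman_def
  proof (rule continuous_on_INF_SUP_expect[OF \<open>Act \<noteq> {}\<close> PP])
    show "compact (S \<times> Act)"
      using \<open>compact S\<close> \<open>compact Act\<close> by (rule compact_Times)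
    fix j
    \<comment> \<open>\<open>g\<close> is known to be affine only on \<open>S \<times> Act\<close>,
      so continuity is proved for the formula and then transferred.\<close>
    have "continuous_on (S \<times> Act)
        (\<lambda>x. A (xi j) *v fst x + B (xi j) *v snd x + b (xi j))"
      by (intro continuous_intros
          bounded_linear.continuous_on[OF matrix_vector_mul_bounded_linear])
    then have "continuous_on (S \<times> Act) (\<lambda>x. g (fst x) (snd x) (xi j))"
      by (rule continuous_on_eq) (auto simp: g_affine)
    then have "continuous_on (S \<times> Act) (\<lambda>x. l (g (fst x) (snd x) (xi j)))"
      by (rule continuous_on_compose2[OF cut_continuous[OF l, of UNIV]]) simp
    with cost_continuous[of "xi j"]
    show "continuous_on (S \<times> Act) (\<lambda>(s, a). C s a (xi j) + \<gamma> * l (g s a (xi j)))"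
      by (auto simp: case_prod_unfold intro!: continuous_intros)
  qed
  have cut_bounded: "bounded (l ` S)" if "l \<in> pool" for l
    using compact_continuous_image[OF cut_continuous[OF that] \<open>compact S\<close>]
    by (rule compact_imp_bounded)
  have pool: "l \<in> pool" if "l \<in> valid_cuts S L pool" for l
    using that by (simp add: valid_cuts_def)
  have valid: "l s \<le> L l s" if "l \<in> valid_cuts S L pool" "s \<in> S" for l s
  proof (rule valid_cutsD[OF that(1) \<open>compact S\<close> _ that(2)])
    show "continuous_on S (\<lambda>s. L l s - l s)"
      using that(1) by (intro continuous_on_diff L_continuous cut_continuous pool)
  qed
  \<comment> \<open>Raising the constant \<open>- ?c\<close> to 0 changes \<open>L\<close> by at
    most \<open>\<gamma> * ?c\<close>, and \<open>L\<close> of 0 is at least \<open>- K\<close>; the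
    sum \<open>- K - \<gamma> * ?c\<close> is again \<open>- ?c\<close>.\<close>
  have const: "- K / (1 - \<gamma>) \<le> L (\<lambda>_. - K / (1 - \<gamma>)) s" if s: "s \<in> S" for s
  proof -
    let ?c = "K / (1 - \<gamma>)"
    have "L (\<lambda>_. 0) s \<le> L (\<lambda>_. - ?c) s + \<gamma> * ?c"
      by (intro discount s) (auto simp: bounded_iff)
    moreover have "K + \<gamma> * ?c = ?c"
      using \<open>\<gamma> < 1\<close> by (simp add: field_simps)
    ultimately show ?thesis
      using zero_bound[OF s] by simp
  qed
  let ?V = "initial_lower_bound (- K / (1 - \<gamma>)) (valid_cuts S L pool)"
  have "finite (valid_cuts S L pool)"
    using \<open>finite pool\<close> by (simp add: valid_cuts_def)
  note sub = initial_lower_bound_subsolution[OF this cut_bounded[OF pool] valid const]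
  have "?V s \<le> L ?V s" "?V s \<le> bounded_fixed_point S L s" if "s \<in> S" for s
    using sub subsolution_le_bounded_fixed_point[OF sub] that by blast+
  then show ?thesis
    by (simp add: Let_def L_def PP_def K_def)
qed

end
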